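(* Every $1$-step relation number is an accumulation (i.e. the limit) of a non-constant sequence of rational length-$5$ half-relation numbers.
   Context: For $q\in\mathbb{R}$ let $A=\begin{pmatrix}1&1\\0&1\end{pmatrix}$ and $B_q=\begin{pmatrix}1&0\\ q&1\end{pmatrix}$. Let $F_2=\langle a,b\rangle$ be the free group on two generators, and for $w\in F_2$ let $w(A,B_q)$ be the image of $w$ under the homomorphism $a\mapsto A$, $b\mapsto B_q$. A real number $q$ is an $n$-step relation number if there exists a non-trivial word of the form $w=b^{m_1}a^{m_2}b^{m_3}\cdots b^{m_{2k+1}}\in F_2$ with $k$ an integer in $[0,n]$ and all exponents $m_i$ nonzero integers, such that $w(A,B_q)$ is upper-triangular. A $1$-step relation number is the case $n=1$. A tuple $(a_1,\dots,a_5)\in\mathbb{Z}^5$ with all $a_i\neq 0$ is a half-relation for $q$ if the matrix $M=A^{a_1}B_q^{a_2}A^{a_3}B_q^{a_4}A^{a_5}$ satisfies $q\,c_{12}(M)-c_{21}(M)=0$, where $c_{ij}(M)$ is the $(i,j)$ entry of $M$. A number $q$ is a length-$5$ half-relation number if there exists such a tuple that is a half-relation for $q$. *)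

theory Defs
  imports "HOL-Analysis.Analysis"
begin

definition matA :: "real^2^2" where
  "matA = vector [vector [1, 1], vector [0, 1]]"

definition matB :: "real \<Rightarrow> real^2^2" where
  "matB q = vector [vector [1, 0], vector [q, 1]]"

text \<open>Integer powers with respect to the matrix product. The overloaded \<open>*\<close> and \<open>^\<close> act
  componentwise on vectors and are not the matrix operations.\<close>

definition mat_int_pow :: "real^2^2 \<Rightarrow> int \<Rightarrow> real^2^2" where
  "mat_int_pow X m =
     (if m \<ge> 0 then (((**) X) ^^ nat m) (mat 1)
      else (((**) (matrix_inv X)) ^^ nat (- m)) (mat 1))"

text \<open>Elements of the free group on two generators are written as lists of syllables
  \<open>x\<^sup>m\<close>. A list in which neighbouring generators differ and all exponents are nonzero is the
  normal form of a unique element; it represents the neutral element only if it is empty.\<close>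

datatype gen = Gen_a | Gen_b

fun gen_mat :: "real \<Rightarrow> gen \<Rightarrow> real^2^2" where
  "gen_mat q Gen_a = matA"
| "gen_mat q Gen_b = matB q"

fun eval_word :: "real \<Rightarrow> (gen \<times> int) list \<Rightarrow> real^2^2" where
  "eval_word q [] = mat 1"
| "eval_word q ((x, m) # w) = mat_int_pow (gen_mat q x) m ** eval_word q w"

text \<open>The word \<open>b^(m 0) a^(m 1) b^(m 2) \<dots>\<close> with \<open>2 * k + 1\<close> syllables; exponents are indexed from 0. When
  they are all nonzero, this is a nonempty normal form, hence a non-trivial element.\<close>

definition alt_word :: "nat \<Rightarrow> (nat \<Rightarrow> int) \<Rightarrow> (gen \<times> int) list" where
  "alt_word k m = map (\<lambda>i. (if even i then Gen_b else Gen_a, m i)) [0..<2 * k + 1]"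

definition upper_triangular2 :: "real^2^2 \<Rightarrow> bool" where
  "upper_triangular2 M \<longleftrightarrow> M $ 2 $ 1 = 0"

definition step_relation_number :: "nat \<Rightarrow> real \<Rightarrow> bool" where
  "step_relation_number n q \<longleftrightarrow>
     (\<exists>k m. k \<le> n \<and> (\<forall>i < 2 * k + 1. m i \<noteq> 0) \<and>
            upper_triangular2 (eval_word q (alt_word k m)))"

definition half_relation5 :: "real \<Rightarrow> int \<Rightarrow> int \<Rightarrow> int \<Rightarrow> int \<Rightarrow> int \<Rightarrow> bool" where
  "half_relation5 q a1 a2 a3 a4 a5 \<longleftrightarrow>
     a1 \<noteq> 0 \<and> a2 \<noteq> 0 \<and> a3 \<noteq> 0 \<and> a4 \<noteq> 0 \<and> a5 \<noteq> 0 \<and>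
     (let M = mat_int_pow matA a1 ** mat_int_pow (matB q) a2 ** mat_int_pow matA a3
              ** mat_int_pow (matB q) a4 ** mat_int_pow matA a5
      in q * M $ 1 $ 2 - M $ 2 $ 1 = 0)"

definition half_relation_number5 :: "real \<Rightarrow> bool" where
  "half_relation_number5 q \<longleftrightarrow> (\<exists>a1 a2 a3 a4 a5. half_relation5 q a1 a2 a3 a4 a5)"

end

theory Submission
  imports Defs
begin

text \<open>
  A word \<open>b\<^sup>m a\<^sup>n b\<^sup>p\<close> has lower left entry \<open>q (m + p + m n p q)\<close>, so a 1-step relation number is a
  root \<open>q\<close> of \<open>m + p + m n p q = 0\<close> for some nonzero integers \<open>m, n, p\<close>; the value \<open>q = 0\<close>, given by
  words with \<open>k = 0\<close>, is the case \<open>m + p = 0\<close>. A tuple \<open>(x, m, n, p, y)\<close> is a half-relation for a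
  nonzero \<open>t\<close> iff \<open>t\<close> is a root of a quadratic polynomial with constant term \<open>x + n + y - m - p\<close>
  (\<open>half_relation5_iff\<close>). Its terms divisible by \<open>x y\<close> are \<open>x y t (m + p + m n p t)\<close>, so when
  \<open>\<bar>x\<bar>\<close> and \<open>\<bar>y\<bar>\<close> grow, one of its roots approaches \<open>q\<close>. It remains to let \<open>x\<close> and \<open>y\<close> grow in such a way
  that this root is rational and different from \<open>q\<close>.

  Choosing \<open>y = m + p - n - x\<close> makes the constant term vanish. Then one root is 0, the other one is
  automatically rational, and it differs from \<open>q\<close> for all large \<open>x\<close> unless \<open>m = n = p\<close>
  (\<open>half_relation_numbers_tend_to_root\<close>). If \<open>m = n = p\<close>, then \<open>q = - 2 / n\<^sup>2\<close>, which also arises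
  from the exponents \<open>1, n\<^sup>2, 1\<close>, and these are not all equal unless \<open>n\<^sup>2 = 1\<close>.

  Only \<open>q = - 2\<close> is left (\<open>half_relation_numbers_tend_to_minus_two\<close>). For \<open>m = n = p = 1\<close> the
  discriminant is \<open>(2 x y)\<^sup>2 + (x + y - 1)\<^sup>2\<close>, so Pythagorean triples with legs \<open>2 x y\<close> and \<open>x + y - 1\<close>
  are needed, the second leg being relatively small. The triples generated by \<open>u\<close> and \<open>u - 1\<close> have
  legs \<open>2 u (u - 1)\<close> and \<open>2 u - 1\<close>, so \<open>x\<close> and \<open>y\<close> must have sum \<open>2 u\<close> and product \<open>u (u - 1)\<close>; they
  are integers when \<open>u = s\<^sup>2\<close> is a square, namely \<open>s\<^sup>2 + s\<close> and \<open>s\<^sup>2 - s\<close>.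
\<close>

section \<open>Words in the two parabolic matrices\<close>

text \<open>Both \<open>A\<close> and \<open>B\<close> lie on one-parameter subgroups, where integer powers multiply the parameter.\<close>

lemma mat_int_pow_one_parameter:
  fixes X :: "real \<Rightarrow> real^2^2"
  assumes add: "\<And>s t. X (s + t) = X s ** X t" and zero: "X 0 = mat 1"
  shows "mat_int_pow (X s) m = X (of_int m * s)"
proof -
  have nat_pow: "(((**) (X t)) ^^ n) (mat 1) = X (real n * t)" for t n
    by (induction n) (simp_all add: zero add distrib_right)
  have right_inv: "X s ** X (- s) = mat 1" and left_inv: "X (- s) ** X s = mat 1"
    using add[of s "- s"] add[of "- s" s] zero by simp_all
  then have "matrix_inv (X s) ** X s = mat 1"
    unfolding matrix_inv_def by - (rule someI2[where a = "X (- s)"], simp_all)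
  then have "matrix_inv (X s) = X (- s)"
    by (metis matrix_mul_assoc matrix_mul_lid matrix_mul_rid right_inv)
  then show ?thesis
    by (simp add: mat_int_pow_def nat_pow)
qed

lemma mat_int_pow_matA:
  "mat_int_pow matA m = vector [vector [1, of_int m], vector [0, 1]]"
proof -
  let ?U = "\<lambda>s. vector [vector [1, s], vector [0, 1]] :: real^2^2"
  have "mat_int_pow (?U 1) m = ?U (of_int m * 1)"
    by (rule mat_int_pow_one_parameter)
      (simp_all add: vec_eq_iff forall_2 matrix_matrix_mult_def sum_2 mat_def)
  then show ?thesis by (simp add: matA_def)
qed

lemma mat_int_pow_matB:
  "mat_int_pow (matB q) m = vector [vector [1, 0], vector [of_int m * q, 1]]"
proof -
  let ?L = "\<lambda>s. vector [vector [1, 0], vector [s, 1]] :: real^2^2"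
  have "mat_int_pow (?L q) m = ?L (of_int m * q)"
    by (rule mat_int_pow_one_parameter)
      (simp_all add: vec_eq_iff forall_2 matrix_matrix_mult_def sum_2 mat_def)
  then show ?thesis by (simp add: matB_def)
qed

lemma half_relation5_iff:
  "half_relation5 t x m n p y \<longleftrightarrow>
     x \<noteq> 0 \<and> m \<noteq> 0 \<and> n \<noteq> 0 \<and> p \<noteq> 0 \<and> y \<noteq> 0 \<and>
     t * (of_int (x * m * n * p * y) * t\<^sup>2
          + of_int (x * y * (m + p) + n * p * y + x * m * n - m * n * p) * t
          + of_int (x + n + y - m - p)) = 0"
  unfolding half_relation5_def Let_def mat_int_pow_matA mat_int_pow_matB
  by (simp add: matrix_matrix_mult_def sum_2 algebra_simps power2_eq_square)

lemma one_step_relation_number_root: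
  assumes "step_relation_number 1 q"
  obtains m n p :: int where "m \<noteq> 0" "n \<noteq> 0" "p \<noteq> 0"
    "of_int (m + p) + of_int (m * n * p) * q = 0"
proof (cases "q = 0")
  case True
  then show ?thesis using that[of 1 1 "- 1"] by simp
next
  case False
  from assms obtain k m where k: "k \<le> 1" and nz: "\<forall>i < 2 * k + 1. m i \<noteq> 0"
    and ut: "upper_triangular2 (eval_word q (alt_word k m))"
    unfolding step_relation_number_def by blast
  \<comment> \<open>A single syllable \<open>b\<^sup>m\<close> is upper triangular only for \<open>q = 0\<close>.\<close>
  have "k \<noteq> 0"
  proof
    assume "k = 0"
    with ut nz False show False
      by (simp add: upper_triangular2_def alt_word_def mat_int_pow_matB)
  qed
  with k have k1: "k = 1" by simp
  have "alt_word 1 m = [(Gen_b, m 0), (Gen_a, m 1), (Gen_b, m 2)]"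
    by (simp add: alt_word_def upt_rec numeral_2_eq_2)
  with ut k1 have "q * (of_int (m 0 + m 2) + of_int (m 0 * m 1 * m 2) * q) = 0"
    by (simp add: upper_triangular2_def mat_int_pow_matA mat_int_pow_matB
        matrix_matrix_mult_def sum_2 mat_def algebra_simps)
  with False nz k1 show ?thesis
    by (intro that[of "m 0" "m 1" "m 2"]) simp_all
qed

section \<open>Rational half-relation numbers near a relation number\<close>

text \<open>With the constant term equal to 0, dividing the linear coefficient by the leading one shows that
  the nonzero root is \<open>q - (1 / (x m) + 1 / (p y) - 1 / (x y))\<close>. The correction tends to 0, and it
  vanishes only if \<open>x (m - p) = p (n - p)\<close>, which is what excluding \<open>m = n = p\<close> prevents for
  large \<open>x\<close>.\<close>

lemma half_relation_numbers_tend_to_root: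
  fixes m n p :: int and q :: real
  assumes nz: "m \<noteq> 0" "n \<noteq> 0" "p \<noteq> 0" and not_all_eq: "\<not> (m = p \<and> n = p)"
    and root: "of_int (m + p) + of_int (m * n * p) * q = 0"
  shows "\<exists>r :: nat \<Rightarrow> real.
           (\<forall>i. r i \<in> \<rat> \<and> half_relation_number5 (r i) \<and> r i \<noteq> q) \<and> r \<longlonglongrightarrow> q"
proof -
  \<comment> \<open>The offset makes \<open>x\<close> positive, \<open>y\<close> negative, and \<open>x\<close> larger than \<open>\<bar>p (p - n)\<bar>\<close>.\<close>
  define K :: int where "K = 1 + \<bar>m\<bar> + \<bar>n\<bar> + \<bar>p\<bar> + \<bar>p * (p - n)\<bar>"
  define x y where "x i = K + int i" and "y i = m + p - n - x i" for i
  define r :: "nat \<Rightarrow> real" where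
    "r i = q - (inverse (of_int (x i)) / of_int m + inverse (of_int (y i)) / of_int p
                - inverse (of_int (x i)) * inverse (of_int (y i)))" for i
  have x_pos: "x i > \<bar>p * (p - n)\<bar>" and x_nz: "x i \<noteq> 0" and y_nz: "y i \<noteq> 0" for i
    unfolding y_def x_def K_def by linarith+
  have q_eq: "q = - of_int (m + p) / of_int (m * n * p)"
    using root nz by (simp add: field_simps)

  have "half_relation5 (r i) (x i) m n p (y i)" for i
  proof -
    \<comment> \<open>What remains of the quadratic polynomial after dividing it by its zero root.\<close>
    have "of_int (x i * m * n * p * y i) * r i
        + of_int (x i * y i * (m + p) + n * p * y i + x i * m * n - m * n * p) = 0"
      unfolding r_def q_eq using nz x_nz[of i] y_nz[of i] by (simp add: field_simps)
    moreover have "x i + n + y i - m - p = 0"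
      by (simp add: y_def)
    ultimately show ?thesis
      unfolding half_relation5_iff using nz x_nz[of i] y_nz[of i]
      by (simp add: power2_eq_square flip: mult.assoc distrib_right)
  qed
  moreover have "r i \<in> \<rat>" for i
    unfolding r_def q_eq by (intro Rats_diff Rats_add Rats_mult Rats_divide Rats_inverse) simp_all
  moreover have "r i \<noteq> q" for i
  proof
    assume "r i = q"
    then have "inverse (of_int (x i)) / of_int m + inverse (of_int (y i)) / of_int p
                - inverse (of_int (x i)) * inverse (of_int (y i)) = (0 :: real)"
      by (simp add: r_def)
    moreover have "of_int (p * y i + x i * m - m * p)
        = (inverse (of_int (x i)) / of_int m + inverse (of_int (y i)) / of_int p
             - inverse (of_int (x i)) * inverse (of_int (y i)))
          * (of_int (x i * y i * m * p) :: real)"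
      using nz x_nz[of i] y_nz[of i] by (simp add: field_simps)
    ultimately have "of_int (p * y i + x i * m - m * p) = (0 :: real)"
      by (simp only: mult_zero_left)
    then have "p * y i + x i * m - m * p = 0"
      by (simp only: of_int_eq_0_iff)
    then have eq: "x i * (m - p) = - (p * (p - n))"
      by (simp add: y_def algebra_simps)
    then have "\<bar>x i\<bar> * \<bar>m - p\<bar> = \<bar>p * (p - n)\<bar>"
      by (metis abs_minus_cancel abs_mult)
    moreover have "m \<noteq> p"
      using eq not_all_eq nz by auto
    then have "\<bar>m - p\<bar> \<ge> 1"
      by linarith
    then have "\<bar>x i\<bar> * \<bar>m - p\<bar> \<ge> \<bar>x i\<bar>"
      by (simp add: mult_le_cancel_left1)
    ultimately show False
      using x_pos[of i] by linarith
  qed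
  moreover have "r \<longlonglongrightarrow> q"
  proof -
    have "filterlim (\<lambda>i. real_of_int (x i)) at_top sequentially"
      unfolding x_def of_int_add of_int_of_nat_eq
      by (intro filterlim_tendsto_add_at_top[OF tendsto_const] filterlim_real_sequentially)
    then have x_inf: "filterlim (\<lambda>i. real_of_int (x i)) at_infinity sequentially"
      by (rule filterlim_at_top_imp_at_infinity)
    have "filterlim (\<lambda>i. of_int (m + p - n) + - real_of_int (x i)) at_infinity sequentially"
      using x_inf by (intro tendsto_add_filterlim_at_infinity[OF tendsto_const])
        (simp add: filterlim_at_infinity_conv_norm_at_top)
    then have "filterlim (\<lambda>i. real_of_int (y i)) at_infinity sequentially"
      by (simp add: y_def)
    then have y_inv: "(\<lambda>i. inverse (real_of_int (y i))) \<longlonglongrightarrow> 0"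
      by (rule tendsto_inverse_0[THEN filterlim_compose])
    have x_inv: "(\<lambda>i. inverse (real_of_int (x i))) \<longlonglongrightarrow> 0"
      using x_inf by (rule tendsto_inverse_0[THEN filterlim_compose])
    have "r \<longlonglongrightarrow> q - (0 / of_int m + 0 / of_int p - 0 * 0)"
      unfolding r_def using nz by (intro tendsto_intros x_inv y_inv) simp_all
    then show ?thesis by simp
  qed
  ultimately show ?thesis
    unfolding half_relation_number5_def by blast
qed

text \<open>The Pythagorean triples generated by \<open>u = s\<^sup>2\<close> and \<open>u - 1\<close> lead to the root
  \<open>- 1 - u / (u - 1)\<close>.\<close>

lemma half_relation_numbers_tend_to_minus_two:
  "\<exists>r :: nat \<Rightarrow> real.
     (\<forall>i. r i \<in> \<rat> \<and> half_relation_number5 (r i) \<and> r i \<noteq> - 2) \<and> r \<longlonglongrightarrow> - 2"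
proof -
  define s :: "nat \<Rightarrow> int" where "s i = int i + 2" for i
  define r :: "nat \<Rightarrow> real" where "r i = - 2 - inverse (of_int ((s i)\<^sup>2 - 1))" for i
  have s_large: "(s i)\<^sup>2 - 1 \<ge> int i + 1" for i
    by (simp add: s_def power2_eq_square algebra_simps)
  have s_nz: "(s i)\<^sup>2 - 1 \<noteq> 0" for i
    using s_large[of i] by linarith
  have "half_relation5 (r i) ((s i)\<^sup>2 + s i) 1 1 1 ((s i)\<^sup>2 - s i)" for i
  proof -
    define S where "S = real_of_int (s i)"
    have "s i * (s i + 1) \<noteq> 0" "s i * (s i - 1) \<noteq> 0"
      by (simp_all add: s_def)
    then have "(s i)\<^sup>2 + s i \<noteq> 0" "(s i)\<^sup>2 - s i \<noteq> 0"
      by (simp_all add: power2_eq_square algebra_simps)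
    moreover have "S\<^sup>2 - 1 \<noteq> 0"
      using s_nz[of i] by (simp add: S_def flip: of_int_power)
    then have "(S\<^sup>2 + S) * (S\<^sup>2 - S) * (r i)\<^sup>2
        + (2 * ((S\<^sup>2 + S) * (S\<^sup>2 - S)) + 2 * S\<^sup>2 - 1) * r i + (2 * S\<^sup>2 - 1) = 0"
      unfolding r_def by (simp add: S_def[symmetric] field_simps) algebra
    ultimately show ?thesis
      unfolding half_relation5_iff by (simp add: S_def algebra_simps)
  qed
  moreover have "r i \<in> \<rat>" for i
    unfolding r_def by (intro Rats_diff Rats_inverse) simp_all
  moreover have "r i \<noteq> - 2" for i
  proof -
    have "inverse (real_of_int ((s i)\<^sup>2 - 1)) \<noteq> 0"
      using s_nz by (simp only: inverse_nonzero_iff_nonzero of_int_eq_0_iff not_False_eq_True)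
    then show ?thesis by (simp only: r_def)
  qed
  moreover have "r \<longlonglongrightarrow> - 2"
  proof -
    have "real i \<le> of_int ((s i)\<^sup>2 - 1)" for i
      using s_large[of i] by linarith
    then have "filterlim (\<lambda>i. real_of_int ((s i)\<^sup>2 - 1)) at_top sequentially"
      by (intro filterlim_at_top_mono[OF filterlim_real_sequentially]) simp
    then have "(\<lambda>i. inverse (real_of_int ((s i)\<^sup>2 - 1))) \<longlonglongrightarrow> 0"
      by (rule tendsto_inverse_0_at_top)
    from tendsto_diff[OF tendsto_const[of "- 2"] this] show ?thesis
      unfolding r_def by simp
  qed
  ultimately show ?thesis
    unfolding half_relation_number5_def by blast
qed

theorem theorem2p7:
  fixes q :: real
  assumes "step_relation_number 1 q"
  shows "\<exists>r :: nat \<Rightarrow> real.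
           (\<forall>n. r n \<in> \<rat> \<and> half_relation_number5 (r n) \<and> r n \<noteq> q) \<and> r \<longlonglongrightarrow> q"
proof -
  from assms obtain m n p where nz: "m \<noteq> 0" "n \<noteq> 0" "p \<noteq> 0"
    and root: "of_int (m + p) + of_int (m * n * p) * q = 0"
    by (rule one_step_relation_number_root)
  consider "\<not> (m = p \<and> n = p)" | "m = p" "n = p" "n\<^sup>2 \<noteq> 1" | "m = p" "n = p" "n\<^sup>2 = 1"
    by blast
  then show ?thesis
  proof cases
    case 1
    with nz root show ?thesis
      by (intro half_relation_numbers_tend_to_root)
  next
    case 2
    have "of_int n * (of_int (1 + 1) + of_int (1 * n\<^sup>2 * 1) * q) = 0"
      using root 2 by (simp add: algebra_simps power2_eq_square)
    with 2 nz show ?thesis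
      by (intro half_relation_numbers_tend_to_root[of 1 "n\<^sup>2" 1]) simp_all
  next
    case 3
    have "of_int n * (2 + of_int (n\<^sup>2) * q) = 0"
      using root 3(1,2) by (simp add: algebra_simps power2_eq_square)
    with 3 nz have "q = - 2"
      by simp
    with half_relation_numbers_tend_to_minus_two show ?thesis
      by simp
  qed
qed

end
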